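(* Let $\gamma:I\to\mathbb{G}$ be a unit speed Frenet curve and let $\beta$ be its natural mate. Then $\gamma$ is a slant helix if and only if $\beta$ is a general helix.
   Context: Let $\mathbb{G}$ be a three-dimensional Lie group with a bi-invariant Riemannian metric $\langle\cdot,\cdot\rangle$, with (oriented) Lie algebra $\mathfrak g$ and Levi-Civita connection $\nabla$; $I\subset\mathbb R$ is an interval and curves are smooth. Vector fields along a curve in $\mathbb G$ are identified with $\mathfrak g$-valued maps by left translation: fixing an orthonormal basis $X_1,X_2,X_3$ of left-invariant fields, write $U=\sum u_iX_i$, and set $U'=\sum u_i'X_i$, $[U,V]=\sum u_iv_j[X_i,X_j]$; then $\nabla_TU=U'+\frac12[T,U]$ with $T=\gamma'$. Vector fields along different curves with the same parameter interval are compared as $\mathfrak g$-valued maps. A unit speed curve $\gamma$ has Frenet-Serret apparatus $\{T,N,B,\kappa,\tau\}$ if $\kappa=\|\nabla_TT\|>0$, $(T,N,B)$ is a positively oriented orthonormal frame, and $\nabla_TT=\kappa N$, $\nabla_TN=-\kappa T+\tau B$, $\nabla_TB=-\tau N$. It is a Frenet curve if moreover $\tau\neq0$. The Lie group torsion is $\tau_{\mathbb G}=\frac12\langle[T,N],B\rangle$; the harmonic curvature is $H=(\tau-\tau_{\mathbb G})/\kappa$. The same notions apply to any unit speed curve with a Frenet-Serret apparatus. A unit speed curve $\beta:I\to\mathbb G$ with Frenet-Serret apparatus $\{\overline T,\overline N,\overline B,\overline\kappa,\overline\tau\}$ is the natural mate of $\gamma$ if $\beta$ is tangent to the principal normal vector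 of $\gamma$, i.e. $\overline T=N$. Characterizations taken as definitions: a curve is a general helix iff its harmonic curvature $H$ is a constant function; a curve is a slant helix iff the function $\sigma=\dfrac{\kappa(H^2+1)^{3/2}}{H'}$ is a constant function. *)

theory Defs
  imports "HOL-Analysis.Analysis" "HOL-Algebra.Group"
begin

section \<open>Three-dimensional Lie groups\<close>

text \<open>
  The definition is meant for sets without isolated points whose derivatives within the set are
  unique; below it is used for open sets and for relatively open subsets of an interval (with
  one-sided derivatives at end points that belong to the interval).
\<close>

primrec Ck_on :: "nat \<Rightarrow> 'a::real_normed_vector set \<Rightarrow> ('a \<Rightarrow> 'b::real_normed_vector) \<Rightarrow> bool" where
  "Ck_on 0 S f \<longleftrightarrow> continuous_on S f"
| "Ck_on (Suc k) S f \<longleftrightarrow>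
     f differentiable_on S \<and> (\<forall>v. Ck_on k S (\<lambda>x. frechet_derivative f (at x within S) v))"

definition smooth_on :: "'a::real_normed_vector set \<Rightarrow> ('a \<Rightarrow> 'b::real_normed_vector) \<Rightarrow> bool" where
  "smooth_on S f \<longleftrightarrow> (\<forall>k. Ck_on k S f)"

type_synonym 'g chart = "'g set \<times> ('g \<Rightarrow> real^3)"

definition is_chart :: "'g::topological_space chart \<Rightarrow> bool" where
  "is_chart = (\<lambda>(U, \<phi>). open U \<and> open (\<phi> ` U) \<and> homeomorphism U (\<phi> ` U) \<phi> (inv_into U \<phi>))"

definition smooth_atlas :: "'g::topological_space chart set \<Rightarrow> bool" where
  "smooth_atlas A \<longleftrightarrow>
     (\<forall>c\<in>A. is_chart c) \<and> (\<Union>(U, \<phi>)\<in>A. U) = UNIV \<and>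
     (\<forall>(U, \<phi>)\<in>A. \<forall>(V, \<psi>)\<in>A. smooth_on (\<phi> ` (U \<inter> V)) (\<psi> \<circ> inv_into U \<phi>))"

text \<open>
  The manifold is the whole type \<open>'g\<close>; the atlas need not be maximal.
\<close>

definition lie_group3 ::
  "'g::{t2_space, second_countable_topology} monoid \<Rightarrow> 'g chart set \<Rightarrow> bool" where
  "lie_group3 G A \<longleftrightarrow>
     group G \<and> carrier G = UNIV \<and> smooth_atlas A \<and>
     continuous_on UNIV (\<lambda>(p, q). p \<otimes>\<^bsub>G\<^esub> q) \<and>
     (\<forall>(U, \<phi>)\<in>A. \<forall>(V, \<psi>)\<in>A. \<forall>(W, \<theta>)\<in>A.
        smooth_on {(x, y). x \<in> \<phi> ` U \<and> y \<in> \<psi> ` V \<and> inv_into U \<phi> x \<otimes>\<^bsub>G\<^esub> inv_into V \<psi> y \<in> W}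
          (\<lambda>(x, y). \<theta> (inv_into U \<phi> x \<otimes>\<^bsub>G\<^esub> inv_into V \<psi> y))) \<and>
     continuous_on UNIV (\<lambda>p. inv\<^bsub>G\<^esub> p) \<and>
     (\<forall>(U, \<phi>)\<in>A. \<forall>(W, \<theta>)\<in>A.
        smooth_on {x \<in> \<phi> ` U. inv\<^bsub>G\<^esub> (inv_into U \<phi> x) \<in> W}
          (\<lambda>x. \<theta> (inv\<^bsub>G\<^esub> (inv_into U \<phi> x))))"


section \<open>Tangent vectors and left-invariant vector fields\<close>

definition smooth_funs :: "'g::topological_space chart set \<Rightarrow> ('g \<Rightarrow> real) set" where
  "smooth_funs A = {f. \<forall>(U, \<phi>)\<in>A. smooth_on (\<phi> ` U) (f \<circ> inv_into U \<phi>)}"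

text \<open>
  Tangent vectors are point derivations of the algebra of smooth functions. They are extended by 0
  to non-smooth functions, so that equality of tangent vectors is equality in HOL.
\<close>

type_synonym 'g tangent = "('g \<Rightarrow> real) \<Rightarrow> real"

definition tangent_space :: "'g::topological_space chart set \<Rightarrow> 'g \<Rightarrow> 'g tangent set" where
  "tangent_space A p = {v.
     (\<forall>f. f \<notin> smooth_funs A \<longrightarrow> v f = 0) \<and>
     (\<forall>f\<in>smooth_funs A. \<forall>h\<in>smooth_funs A. \<forall>a b. v (\<lambda>q. a * f q + b * h q) = a * v f + b * v h) \<and>
     (\<forall>f\<in>smooth_funs A. \<forall>h\<in>smooth_funs A. v (\<lambda>q. f q * h q) = f p * v h + h p * v f)}"

definition vector_fields :: "'g::topological_space chart set \<Rightarrow> ('g \<Rightarrow> 'g tangent) set" where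
  "vector_fields A = {X. (\<forall>p. X p \<in> tangent_space A p) \<and>
     (\<forall>f\<in>smooth_funs A. (\<lambda>p. X p f) \<in> smooth_funs A)}"

definition push :: "('g \<Rightarrow> 'g) \<Rightarrow> 'g tangent \<Rightarrow> 'g tangent" where
  "push F v = (\<lambda>f. v (f \<circ> F))"

definition left_invariant :: "'g monoid \<Rightarrow> ('g \<Rightarrow> 'g tangent) \<Rightarrow> bool" where
  "left_invariant G X \<longleftrightarrow> (\<forall>a p. X (a \<otimes>\<^bsub>G\<^esub> p) = push (\<lambda>q. a \<otimes>\<^bsub>G\<^esub> q) (X p))"

definition lie_bracket :: "('g \<Rightarrow> 'g tangent) \<Rightarrow> ('g \<Rightarrow> 'g tangent) \<Rightarrow> 'g \<Rightarrow> 'g tangent" where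
  "lie_bracket X Y p = (\<lambda>f. X p (\<lambda>q. Y q f) - Y p (\<lambda>q. X q f))"


section \<open>Bi-invariant Riemannian metrics\<close>

type_synonym 'g metric = "'g \<Rightarrow> 'g tangent \<Rightarrow> 'g tangent \<Rightarrow> real"

definition riemannian_metric :: "'g::topological_space chart set \<Rightarrow> 'g metric \<Rightarrow> bool" where
  "riemannian_metric A g \<longleftrightarrow>
     (\<forall>p. \<forall>u\<in>tangent_space A p. \<forall>v\<in>tangent_space A p.
        g p u v = g p v u \<and> (v \<noteq> (\<lambda>f. 0) \<longrightarrow> g p v v > 0) \<and>
        (\<forall>w\<in>tangent_space A p. \<forall>a b.
           g p (\<lambda>f. a * u f + b * v f) w = a * g p u w + b * g p v w)) \<and>
     (\<forall>X\<in>vector_fields A. \<forall>Y\<in>vector_fields A. (\<lambda>p. g p (X p) (Y p)) \<in> smooth_funs A)"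

definition bi_invariant_metric ::
  "'g::topological_space monoid \<Rightarrow> 'g chart set \<Rightarrow> 'g metric \<Rightarrow> bool" where
  "bi_invariant_metric G A g \<longleftrightarrow> riemannian_metric A g \<and>
     (\<forall>a p. \<forall>v\<in>tangent_space A p. \<forall>w\<in>tangent_space A p.
        g (a \<otimes>\<^bsub>G\<^esub> p) (push (\<lambda>q. a \<otimes>\<^bsub>G\<^esub> q) v) (push (\<lambda>q. a \<otimes>\<^bsub>G\<^esub> q) w) = g p v w \<and>
        g (p \<otimes>\<^bsub>G\<^esub> a) (push (\<lambda>q. q \<otimes>\<^bsub>G\<^esub> a) v) (push (\<lambda>q. q \<otimes>\<^bsub>G\<^esub> a) w) = g p v w)"

text \<open>
  Since the Lie algebra has dimension 3, an orthonormal triple \<open>X 1, X 2, X 3\<close> of left-invariant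
  fields is a basis of it. This basis is taken to be positively oriented, that is, it fixes the
  orientation of the Lie algebra.
\<close>

definition left_orthonormal_basis ::
  "'g::topological_space monoid \<Rightarrow> 'g chart set \<Rightarrow> 'g metric \<Rightarrow> (3 \<Rightarrow> 'g \<Rightarrow> 'g tangent) \<Rightarrow> bool" where
  "left_orthonormal_basis G A g X \<longleftrightarrow>
     (\<forall>i. X i \<in> vector_fields A \<and> left_invariant G (X i)) \<and>
     (\<forall>p i j. g p (X i p) (X j p) = (if i = j then 1 else 0))"


section \<open>Curves and the Levi-Civita connection along them\<close>

definition smooth_curve ::
  "'g::topological_space chart set \<Rightarrow> real set \<Rightarrow> (real \<Rightarrow> 'g) \<Rightarrow> bool" where
  "smooth_curve A I \<gamma> \<longleftrightarrow> continuous_on I \<gamma> \<and>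
     (\<forall>(U, \<phi>)\<in>A. smooth_on {s \<in> I. \<gamma> s \<in> U} (\<phi> \<circ> \<gamma>))"

definition velocity ::
  "'g::topological_space chart set \<Rightarrow> real set \<Rightarrow> (real \<Rightarrow> 'g) \<Rightarrow> real \<Rightarrow> 'g tangent" where
  "velocity A I \<gamma> s =
     (\<lambda>f. if f \<in> smooth_funs A then vector_derivative (f \<circ> \<gamma>) (at s within I) else 0)"

definition unit_speed_curve ::
  "'g::topological_space chart set \<Rightarrow> 'g metric \<Rightarrow> real set \<Rightarrow> (real \<Rightarrow> 'g) \<Rightarrow> bool" where
  "unit_speed_curve A g I \<gamma> \<longleftrightarrow> smooth_curve A I \<gamma> \<and>
     (\<forall>s\<in>I. g (\<gamma> s) (velocity A I \<gamma> s) (velocity A I \<gamma> s) = 1)"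

text \<open>
  From here on a vector field \<open>U\<close> along a curve, i.e. a map into the Lie algebra, is represented by
  its coordinates with respect to the orthonormal basis \<open>X\<close>, as a map from the parameter interval
  to \<open>real^3\<close>. The metric then becomes the standard inner product, and the orientation the
  standard one.
\<close>

definition left_coords ::
  "'g metric \<Rightarrow> (3 \<Rightarrow> 'g \<Rightarrow> 'g tangent) \<Rightarrow> 'g \<Rightarrow> 'g tangent \<Rightarrow> real^3" where
  "left_coords g X p v = (\<chi> i. g p v (X i p))"

definition lie_br ::
  "'g monoid \<Rightarrow> 'g metric \<Rightarrow> (3 \<Rightarrow> 'g \<Rightarrow> 'g tangent) \<Rightarrow> real^3 \<Rightarrow> real^3 \<Rightarrow> real^3" where
  "lie_br G g X u v =
     (\<Sum>i\<in>UNIV. \<Sum>j\<in>UNIV. (u $ i * v $ j) *\<^sub>R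
        left_coords g X \<one>\<^bsub>G\<^esub> (lie_bracket (X i) (X j) \<one>\<^bsub>G\<^esub>))"

text \<open>
  The Levi-Civita covariant derivative along a curve with tangent field \<open>T\<close>, given for a
  bi-invariant metric and in the left trivialization by \<open>U' + [T, U] / 2\<close>.
\<close>

definition nabla ::
  "'g monoid \<Rightarrow> 'g metric \<Rightarrow> (3 \<Rightarrow> 'g \<Rightarrow> 'g tangent) \<Rightarrow> real set \<Rightarrow>
   (real \<Rightarrow> real^3) \<Rightarrow> (real \<Rightarrow> real^3) \<Rightarrow> real \<Rightarrow> real^3" where
  "nabla G g X I T U s =
     vector_derivative U (at s within I) + (1/2) *\<^sub>R lie_br G g X (T s) (U s)"


section \<open>Frenet-Serret apparatus, helices and natural mates\<close>

definition pos_orthonormal :: "real^3 \<Rightarrow> real^3 \<Rightarrow> real^3 \<Rightarrow> bool" where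
  "pos_orthonormal t n b \<longleftrightarrow>
     norm t = 1 \<and> norm n = 1 \<and> norm b = 1 \<and> t \<bullet> n = 0 \<and> t \<bullet> b = 0 \<and> n \<bullet> b = 0 \<and>
     det (vector [t, n, b] :: real^3^3) > 0"

text \<open>
  The smoothness of the frame fields only says that they may be differentiated; it is automatic for
  the Frenet frame of a smooth curve.
\<close>

definition frenet_apparatus ::
  "'g::topological_space monoid \<Rightarrow> 'g chart set \<Rightarrow> 'g metric \<Rightarrow> (3 \<Rightarrow> 'g \<Rightarrow> 'g tangent) \<Rightarrow>
   real set \<Rightarrow> (real \<Rightarrow> 'g) \<Rightarrow> (real \<Rightarrow> real^3) \<Rightarrow> (real \<Rightarrow> real^3) \<Rightarrow> (real \<Rightarrow> real^3) \<Rightarrow>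
   (real \<Rightarrow> real) \<Rightarrow> (real \<Rightarrow> real) \<Rightarrow> bool" where
  "frenet_apparatus G A g X I \<gamma> T N B \<kappa> \<tau> \<longleftrightarrow>
     unit_speed_curve A g I \<gamma> \<and>
     smooth_on I T \<and> smooth_on I N \<and> smooth_on I B \<and>
     (\<forall>s\<in>I. T s = left_coords g X (\<gamma> s) (velocity A I \<gamma> s) \<and>
        pos_orthonormal (T s) (N s) (B s) \<and>
        \<kappa> s = norm (nabla G g X I T T s) \<and> \<kappa> s > 0 \<and>
        nabla G g X I T T s = \<kappa> s *\<^sub>R N s \<and>
        nabla G g X I T N s = - \<kappa> s *\<^sub>R T s + \<tau> s *\<^sub>R B s \<and>
        nabla G g X I T B s = - \<tau> s *\<^sub>R N s)"

definition frenet_curve ::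
  "'g::topological_space monoid \<Rightarrow> 'g chart set \<Rightarrow> 'g metric \<Rightarrow> (3 \<Rightarrow> 'g \<Rightarrow> 'g tangent) \<Rightarrow>
   real set \<Rightarrow> (real \<Rightarrow> 'g) \<Rightarrow> (real \<Rightarrow> real^3) \<Rightarrow> (real \<Rightarrow> real^3) \<Rightarrow> (real \<Rightarrow> real^3) \<Rightarrow>
   (real \<Rightarrow> real) \<Rightarrow> (real \<Rightarrow> real) \<Rightarrow> bool" where
  "frenet_curve G A g X I \<gamma> T N B \<kappa> \<tau> \<longleftrightarrow>
     frenet_apparatus G A g X I \<gamma> T N B \<kappa> \<tau> \<and> (\<forall>s\<in>I. \<tau> s \<noteq> 0)"

definition natural_mate :: "real set \<Rightarrow> (real \<Rightarrow> real^3) \<Rightarrow> (real \<Rightarrow> real^3) \<Rightarrow> bool" where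
  "natural_mate I N Tbar \<longleftrightarrow> (\<forall>s\<in>I. Tbar s = N s)"

definition lie_torsion ::
  "'g monoid \<Rightarrow> 'g metric \<Rightarrow> (3 \<Rightarrow> 'g \<Rightarrow> 'g tangent) \<Rightarrow>
   (real \<Rightarrow> real^3) \<Rightarrow> (real \<Rightarrow> real^3) \<Rightarrow> (real \<Rightarrow> real^3) \<Rightarrow> real \<Rightarrow> real" where
  "lie_torsion G g X T N B s = (1/2) * (lie_br G g X (T s) (N s) \<bullet> B s)"

definition harmonic_curvature ::
  "'g monoid \<Rightarrow> 'g metric \<Rightarrow> (3 \<Rightarrow> 'g \<Rightarrow> 'g tangent) \<Rightarrow>
   (real \<Rightarrow> real^3) \<Rightarrow> (real \<Rightarrow> real^3) \<Rightarrow> (real \<Rightarrow> real^3) \<Rightarrow>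
   (real \<Rightarrow> real) \<Rightarrow> (real \<Rightarrow> real) \<Rightarrow> real \<Rightarrow> real" where
  "harmonic_curvature G g X T N B \<kappa> \<tau> s = (\<tau> s - lie_torsion G g X T N B s) / \<kappa> s"

definition general_helix :: "real set \<Rightarrow> (real \<Rightarrow> real) \<Rightarrow> bool" where
  "general_helix I H \<longleftrightarrow> H constant_on I"

text \<open>
  The numerator of \<open>\<sigma>\<close> never vanishes, so that with \<open>x / 0 = 0\<close> the value 0 stands exactly for
  \<open>\<sigma> = \<infinity>\<close>, i.e. \<open>H' = 0\<close>. Thus \<open>\<sigma>\<close> is constant iff either \<open>H'\<close> has no zero and the quotient is
  constant, or \<open>H'\<close> vanishes identically; in the latter case the curve is a general helix, whose
  principal normal is orthogonal to the axis, hence a (degenerate) slant helix.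
\<close>

definition slant_sigma :: "real set \<Rightarrow> (real \<Rightarrow> real) \<Rightarrow> (real \<Rightarrow> real) \<Rightarrow> real \<Rightarrow> real" where
  "slant_sigma I \<kappa> H s =
     \<kappa> s * ((H s)\<^sup>2 + 1) powr (3/2) / vector_derivative H (at s within I)"

definition slant_helix :: "real set \<Rightarrow> (real \<Rightarrow> real) \<Rightarrow> (real \<Rightarrow> real) \<Rightarrow> bool" where
  "slant_helix I \<kappa> H \<longleftrightarrow> slant_sigma I \<kappa> H constant_on I"

end

theory Submission
  imports Defs "HOL-Analysis.Cross3"
begin

text \<open>
  Write \<open>H\<close> for the harmonic curvature of \<open>\<gamma>\<close> and \<open>H\<^sub>\<beta>\<close> for that of its natural mate. The theorem
  holds because \<open>\<sigma> = 1 / H\<^sub>\<beta>\<close> pointwise, also at the points where \<open>H' = 0\<close>, at which both sides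
  are 0 under the convention \<open>x / 0 = 0\<close>.

  In the left trivialization a Frenet frame of a curve in the group is an orthonormal frame in
  \<open>\<real>\<^sup>3\<close>, and the bracket terms of the connection only shift the torsion: componentwise
  differentiation gives
    \<open>T' = \<kappa> N\<close>, \<open>N' = - \<kappa> T + \<kappa> H B\<close> and \<open>B' = - \<kappa> H N\<close> (\<open>frenet_frame_equations\<close>).
  The first equation rests on \<open>[T, T] = 0\<close>, the other two follow from it, from the definition of
  \<open>\<tau>\<^sub>G\<close> and from orthonormality.

  With these equations the problem is one about curves of frames in \<open>\<real>\<^sup>3\<close>. Since the mate has
  tangent \<open>N\<close>, the equation for \<open>N'\<close> shows that its principal normal is \<open>(- T + H B) / w\<close> with
  \<open>w = \<surd>(1 + H\<^sup>2)\<close>, that its curvature is \<open>w \<kappa>\<close>, and that its binormal is \<open>(B + H T) / w\<close>. Thus the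
  normal plane of the mate is the plane of \<open>T\<close> and \<open>B\<close>, and its frame is rotated in it by the angle
  \<open>arctan H\<close>. The speed \<open>H' / (1 + H\<^sup>2)\<close> of this rotation is the (shifted) torsion of the mate, and
  dividing it by \<open>w \<kappa>\<close> gives \<open>H\<^sub>\<beta> = H' / (\<kappa> (1 + H\<^sup>2)\<^bsup>3/2\<^esup>)\<close> (\<open>mate_harmonic_curvature\<close>).
\<close>

section \<open>The bracket on the Lie algebra is alternating\<close>

lemma Ck_on_Suc_imp: "Ck_on (Suc k) S f \<Longrightarrow> Ck_on k S f"
proof (induction k arbitrary: f)
  case 0
  then show ?case by (simp add: differentiable_imp_continuous_on)
next
  case (Suc k)
  then show ?case by (metis Ck_on.simps(2))
qed

lemma Ck_on_cong:
  assumes "\<And>x. x \<in> S \<Longrightarrow> f x = h x" and "Ck_on k S f"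
  shows "Ck_on k S h"
  using assms
proof (induction k arbitrary: f h)
  case 0
  then show ?case by (simp cong: continuous_on_cong)
next
  case (Suc k)
  have der: "(f has_derivative F) (at x within S) \<longleftrightarrow> (h has_derivative F) (at x within S)"
    if "x \<in> S" for x F
    using that Suc.prems(1) has_derivative_transform[of x S h f F]
      has_derivative_transform[of x S f h F] by auto
  then have eq: "frechet_derivative f (at x within S) = frechet_derivative h (at x within S)"
    if "x \<in> S" for x
    using that by (simp add: frechet_derivative_def)
  have "h differentiable_on S"
    using Suc.prems(2) der by (simp add: differentiable_on_def differentiable_def)
  moreover have "Ck_on k S (\<lambda>x. frechet_derivative h (at x within S) v)" for v
  proof (rule Suc.IH)
    show "Ck_on k S (\<lambda>x. frechet_derivative f (at x within S) v)"
      using Suc.prems(2) by simp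
  qed (simp add: eq)
  ultimately show ?case by simp
qed

lemma Ck_on_SucI:
  assumes "open S"
    and "\<And>x. x \<in> S \<Longrightarrow> (f has_derivative F x) (at x)"
    and "\<And>v. Ck_on k S (\<lambda>x. F x v)"
  shows "Ck_on (Suc k) S f"
proof -
  have "F x v = frechet_derivative f (at x within S) v" if "x \<in> S" for x v
    using frechet_derivative_at[OF assms(2)[OF that]] at_within_open[OF that assms(1)] by simp
  then have "Ck_on k S (\<lambda>x. frechet_derivative f (at x within S) v)" for v
    by (rule Ck_on_cong[OF _ assms(3)])
  moreover have "f differentiable_on S"
    unfolding differentiable_on_def differentiable_def
    using assms(2) has_derivative_at_withinI by blast
  ultimately show ?thesis by simp
qed

lemma Ck_on_SucD:
  assumes "open S" and "Ck_on (Suc k) S f" and "x \<in> S"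
  shows "(f has_derivative frechet_derivative f (at x within S)) (at x)"
proof -
  have "f differentiable (at x within S)"
    using assms(2,3) by (simp add: differentiable_on_def)
  then show ?thesis
    unfolding frechet_derivative_works at_within_open[OF assms(3,1)] .
qed

lemma Ck_on_add:
  assumes "open S" and "Ck_on k S f" and "Ck_on k S h"
  shows "Ck_on k S (\<lambda>x. f x + h x)"
  using assms(2,3)
proof (induction k arbitrary: f h)
  case 0
  then show ?case by (simp add: continuous_on_add)
next
  case (Suc k)
  show ?case
  proof (rule Ck_on_SucI[OF assms(1)])
    show "((\<lambda>x. f x + h x) has_derivative
        (\<lambda>v. frechet_derivative f (at x within S) v + frechet_derivative h (at x within S) v)) (at x)"
      if "x \<in> S" for x
      using Ck_on_SucD[OF assms(1) Suc.prems(1) that] Ck_on_SucD[OF assms(1) Suc.prems(2) that]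
      by (rule has_derivative_add)
  qed (use Suc in simp)
qed

lemma Ck_on_mult:
  fixes f h :: "'a::real_normed_vector \<Rightarrow> real"
  assumes "open S" and "Ck_on k S f" and "Ck_on k S h"
  shows "Ck_on k S (\<lambda>x. f x * h x)"
  using assms(2,3)
proof (induction k arbitrary: f h)
  case 0
  then show ?case by (simp add: continuous_on_mult)
next
  case (Suc k)
  show ?case
  proof (rule Ck_on_SucI[OF assms(1)])
    show "((\<lambda>x. f x * h x) has_derivative
        (\<lambda>v. f x * frechet_derivative h (at x within S) v + frechet_derivative f (at x within S) v * h x)) (at x)"
      if "x \<in> S" for x
      using Ck_on_SucD[OF assms(1) Suc.prems(1) that] Ck_on_SucD[OF assms(1) Suc.prems(2) that]
      by (rule has_derivative_mult)
    show "Ck_on k S (\<lambda>x. f x * frechet_derivative h (at x within S) v + frechet_derivative f (at x within S) v * h x)"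
      for v
    proof (rule Ck_on_add[OF assms(1)]; rule Suc.IH)
      show "Ck_on k S f" "Ck_on k S h"
        using Suc.prems by (simp_all only: Ck_on_Suc_imp)
    qed (use Suc.prems in simp_all)
  qed
qed

lemma smooth_funs_mult:
  assumes "smooth_atlas A" and "f \<in> smooth_funs A" and "h \<in> smooth_funs A"
  shows "(\<lambda>q. f q * h q) \<in> smooth_funs A"
  unfolding smooth_funs_def
proof (clarify)
  fix U \<phi> assume c: "(U, \<phi>) \<in> A"
  have "open (\<phi> ` U)"
    using assms(1) c by (auto simp: smooth_atlas_def is_chart_def)
  moreover have "smooth_on (\<phi> ` U) (f \<circ> inv_into U \<phi>)" "smooth_on (\<phi> ` U) (h \<circ> inv_into U \<phi>)"
    using assms(2,3) c by (auto simp: smooth_funs_def)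
  ultimately show "smooth_on (\<phi> ` U) ((\<lambda>q. f q * h q) \<circ> inv_into U \<phi>)"
    by (simp add: smooth_on_def o_def Ck_on_mult)
qed

text \<open>
  A metric is linear only on tangent spaces, so the skew-symmetry of its values on brackets depends
  on this membership. In the Leibniz
  rule the terms \<open>X f Y h\<close> and \<open>X h Y f\<close> cancel; to split the derivative of
  \<open>f Y h + h Y f\<close>, the products must again be smooth functions.
\<close>

lemma lie_bracket_in_tangent_space:
  assumes "smooth_atlas A" and "X \<in> vector_fields A" and "Y \<in> vector_fields A"
  shows "lie_bracket X Y p \<in> tangent_space A p"
proof -
  have lin: "Z q (\<lambda>r. a * f r + b * h r) = a * Z q f + b * Z q h"
    if "Z \<in> vector_fields A" "f \<in> smooth_funs A" "h \<in> smooth_funs A" for Z q a b f h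
    using that by (simp add: vector_fields_def tangent_space_def)
  have add: "Z q (\<lambda>r. f r + h r) = Z q f + Z q h"
    if "Z \<in> vector_fields A" "f \<in> smooth_funs A" "h \<in> smooth_funs A" for Z q f h
    using lin[OF that, of q 1 1] by simp
  have leib: "Z q (\<lambda>r. f r * h r) = f q * Z q h + h q * Z q f"
    if "Z \<in> vector_fields A" "f \<in> smooth_funs A" "h \<in> smooth_funs A" for Z q f h
    using that by (simp add: vector_fields_def tangent_space_def)
  have nonsmooth: "Z q f = 0" if "Z \<in> vector_fields A" "f \<notin> smooth_funs A" for Z q f
    using that by (simp add: vector_fields_def tangent_space_def)
  have smooth: "(\<lambda>q. Z q f) \<in> smooth_funs A"
    if "Z \<in> vector_fields A" "f \<in> smooth_funs A" for Z f
    using that by (simp add: vector_fields_def)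
  have zero: "Z q (\<lambda>r. 0) = 0" if "Z \<in> vector_fields A" for Z q
  proof (cases "(\<lambda>r. 0) \<in> smooth_funs A")
    case True
    show ?thesis using lin[OF that True True, of q 0 0] by simp
  qed (use nonsmooth that in blast)
  note prod = smooth_funs_mult[OF assms(1)]
  show ?thesis
    unfolding tangent_space_def lie_bracket_def
  proof (clarsimp simp: nonsmooth zero assms(2,3), intro conjI ballI allI)
    fix f h a b assume fh: "f \<in> smooth_funs A" "h \<in> smooth_funs A"
    note lin_XY = lin[OF assms(2) smooth[OF assms(3) fh(1)] smooth[OF assms(3) fh(2)]]
    note lin_YX = lin[OF assms(3) smooth[OF assms(2) fh(1)] smooth[OF assms(2) fh(2)]]
    show "X p (\<lambda>q. Y q (\<lambda>q. a * f q + b * h q)) - Y p (\<lambda>q. X q (\<lambda>q. a * f q + b * h q)) =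
        a * (X p (\<lambda>q. Y q f) - Y p (\<lambda>q. X q f)) + b * (X p (\<lambda>q. Y q h) - Y p (\<lambda>q. X q h))"
      unfolding lin[OF assms(2) fh] lin[OF assms(3) fh] lin_XY lin_YX by (simp add: algebra_simps)
  next
    fix f h assume fh: "f \<in> smooth_funs A" "h \<in> smooth_funs A"
    note add_XY = add[OF assms(2) prod[OF fh(1) smooth[OF assms(3) fh(2)]]
        prod[OF fh(2) smooth[OF assms(3) fh(1)]]]
    note add_YX = add[OF assms(3) prod[OF fh(1) smooth[OF assms(2) fh(2)]]
        prod[OF fh(2) smooth[OF assms(2) fh(1)]]]
    note leib_XY = leib[OF assms(2) fh(1) smooth[OF assms(3) fh(2)]]
      leib[OF assms(2) fh(2) smooth[OF assms(3) fh(1)]]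
    note leib_YX = leib[OF assms(3) fh(1) smooth[OF assms(2) fh(2)]]
      leib[OF assms(3) fh(2) smooth[OF assms(2) fh(1)]]
    show "X p (\<lambda>q. Y q (\<lambda>q. f q * h q)) - Y p (\<lambda>q. X q (\<lambda>q. f q * h q)) =
        f p * (X p (\<lambda>q. Y q h) - Y p (\<lambda>q. X q h)) + h p * (X p (\<lambda>q. Y q f) - Y p (\<lambda>q. X q f))"
      unfolding leib[OF assms(2) fh] leib[OF assms(3) fh] add_XY add_YX leib_XY leib_YX
      by (simp add: algebra_simps)
  qed
qed

lemma lie_br_self:
  assumes "smooth_atlas A" and "riemannian_metric A g" and X: "\<And>i. X i \<in> vector_fields A"
  shows "lie_br G g X u u = 0"
proof -
  define c where "c i j = left_coords g X \<one>\<^bsub>G\<^esub> (lie_bracket (X i) (X j) \<one>\<^bsub>G\<^esub>)" for i j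
  have skew: "c j i = - c i j" for i j
  proof -
    let ?v = "lie_bracket (X i) (X j) \<one>\<^bsub>G\<^esub>"
    have v: "?v \<in> tangent_space A \<one>\<^bsub>G\<^esub>"
      by (rule lie_bracket_in_tangent_space[OF assms(1) X X])
    have "lie_bracket (X j) (X i) \<one>\<^bsub>G\<^esub> = (\<lambda>f. (-1) * ?v f + 0 * ?v f)"
      by (auto simp: lie_bracket_def)
    moreover have "g \<one>\<^bsub>G\<^esub> (\<lambda>f. (-1) * ?v f + 0 * ?v f) (X k \<one>\<^bsub>G\<^esub>)
        = (-1) * g \<one>\<^bsub>G\<^esub> ?v (X k \<one>\<^bsub>G\<^esub>) + 0 * g \<one>\<^bsub>G\<^esub> ?v (X k \<one>\<^bsub>G\<^esub>)" for k
      using assms(2) v X[of k] unfolding riemannian_metric_def vector_fields_def by blast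
    ultimately show ?thesis
      by (simp add: c_def left_coords_def vec_eq_iff)
  qed
  let ?S = "\<Sum>i\<in>UNIV. \<Sum>j\<in>UNIV. (u $ i * u $ j) *\<^sub>R c i j"
  have "?S = (\<Sum>i\<in>UNIV. \<Sum>j\<in>UNIV. (u $ j * u $ i) *\<^sub>R c j i)"
    by (rule sum.swap)
  also have "\<dots> = (\<Sum>i\<in>UNIV. \<Sum>j\<in>UNIV. - ((u $ i * u $ j) *\<^sub>R c i j))"
    by (intro sum.cong refl) (metis skew mult.commute scaleR_minus_right)
  also have "\<dots> = - ?S"
    by (simp add: sum_negf)
  finally have "?S = 0"
    by (simp add: eq_neg_iff_add_eq_0 flip: scaleR_2)
  then show ?thesis by (simp add: lie_br_def c_def)
qed


section \<open>Moving orthonormal frames in three-space\<close>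

text \<open>
  Both \<open>b\<close> and \<open>t \<times> n\<close> are unit vectors orthogonal to \<open>t\<close> and \<open>n\<close>, hence parallel, and the sign
  of the determinant excludes \<open>b = - (t \<times> n)\<close>.
\<close>

lemma pos_orthonormal_cross:
  assumes "pos_orthonormal t n b"
  shows "b = cross3 t n"
proof -
  let ?c = "cross3 t n"
  have on: "t \<bullet> t = 1" "n \<bullet> n = 1" "b \<bullet> b = 1" "t \<bullet> n = 0" "t \<bullet> b = 0" "n \<bullet> b = 0"
    using assms by (simp_all add: pos_orthonormal_def norm_eq_1)
  have cc: "?c \<bullet> ?c = 1"
    using dot_cross[of t n t n] on by (simp add: inner_commute)
  have "cross3 b ?c = 0"
    using on by (simp add: Lagrange inner_commute)
  then have "(b \<bullet> ?c)\<^sup>2 = 1"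
    using norm_cross_dot[of b ?c] on(3) cc by (simp add: norm_eq_sqrt_inner)
  moreover have "b \<bullet> ?c > 0"
  proof -
    have "det (vector [t, n, b] :: real^3^3) = b \<bullet> ?c"
      by (metis cross_triple dot_cross_det inner_commute)
    then show ?thesis using assms by (simp add: pos_orthonormal_def)
  qed
  ultimately have "b \<bullet> ?c = 1"
    by (metis abs_of_pos abs_1 power2_eq_1_iff power2_eq_iff_nonneg less_imp_le zero_le_one one_power2)
  then have "(b - ?c) \<bullet> (b - ?c) = 0"
    using on cc by (simp add: inner_diff inner_commute)
  then show ?thesis by simp
qed

lemma pos_orthonormal_expand:
  assumes "pos_orthonormal t n b"
  shows "v = (v \<bullet> t) *\<^sub>R t + (v \<bullet> n) *\<^sub>R n + (v \<bullet> b) *\<^sub>R b"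
proof -
  define u where "u = v - ((v \<bullet> t) *\<^sub>R t + (v \<bullet> n) *\<^sub>R n + (v \<bullet> b) *\<^sub>R b)"
  have on: "t \<bullet> t = 1" "n \<bullet> n = 1" "b \<bullet> b = 1" "t \<bullet> n = 0" "t \<bullet> b = 0" "n \<bullet> b = 0"
    using assms by (simp_all add: pos_orthonormal_def norm_eq_1)
  have orth: "u \<bullet> t = 0" "u \<bullet> n = 0" "u \<bullet> b = 0"
    using on by (simp_all add: u_def inner_diff inner_add inner_commute)
  have "cross3 u b = 0"
    unfolding pos_orthonormal_cross[OF assms] using orth by (simp add: Lagrange)
  then have "u = 0"
    using norm_and_cross_eq_0[of u b] orth(3) on(3) by auto
  then show ?thesis by (simp add: u_def)
qed

lemma inner_const_derivative:
  fixes f h :: "real \<Rightarrow> 'a::real_inner"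
  assumes "at s within I \<noteq> bot" and "s \<in> I"
    and "(f has_vector_derivative f') (at s within I)"
    and "(h has_vector_derivative h') (at s within I)"
    and "\<And>r. r \<in> I \<Longrightarrow> f r \<bullet> h r = c"
  shows "f' \<bullet> h s + f s \<bullet> h' = 0"
proof -
  have "((\<lambda>r. f r \<bullet> h r) has_vector_derivative f s \<bullet> h' + f' \<bullet> h s) (at s within I)"
    using bounded_bilinear.has_vector_derivative[OF bounded_bilinear_inner assms(3,4)] .
  moreover have "((\<lambda>r. f r \<bullet> h r) has_vector_derivative 0) (at s within I)"
    by (rule has_vector_derivative_transform[OF assms(2) _ has_vector_derivative_const[of c]])
      (simp add: assms(5))
  ultimately show ?thesis
    using vector_derivative_unique_within[OF assms(1)] by (fastforce simp: add.commute)
qed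

lemma smooth_on_has_vector_derivative:
  assumes "smooth_on I U" and "s \<in> I"
  shows "(U has_vector_derivative vector_derivative U (at s within I)) (at s within I)"
proof -
  have "Ck_on (Suc 0) I U" using assms(1) unfolding smooth_on_def by blast
  then show ?thesis
    using assms(2) by (simp add: differentiable_on_def flip: vector_derivative_works)
qed

lemma smooth_on_vector_derivative_differentiable:
  assumes "smooth_on I U" and "s \<in> I" and "\<And>r. r \<in> I \<Longrightarrow> at r within I \<noteq> bot"
  shows "(\<lambda>r. vector_derivative U (at r within I)) differentiable (at s within I)"
proof -
  have C: "Ck_on (Suc (Suc 0)) I U" using assms(1) unfolding smooth_on_def by blast
  have eq: "vector_derivative U (at r within I) = frechet_derivative U (at r within I) 1"
    if "r \<in> I" for r
  proof (rule vector_derivative_within[OF assms(3)[OF that]])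
    have D: "(U has_derivative frechet_derivative U (at r within I)) (at r within I)"
      using C that by (simp add: differentiable_on_def flip: frechet_derivative_works)
    have "frechet_derivative U (at r within I) = (\<lambda>x. x *\<^sub>R frechet_derivative U (at r within I) 1)"
    proof (intro ext)
      fix x :: real
      show "frechet_derivative U (at r within I) x = x *\<^sub>R frechet_derivative U (at r within I) 1"
        using linear_scale[OF has_derivative_linear[OF D], of x 1] by simp
    qed
    then show "(U has_vector_derivative frechet_derivative U (at r within I) 1) (at r within I)"
      using D by (simp add: has_vector_derivative_def)
  qed
  have "(\<lambda>r. frechet_derivative U (at r within I) 1) differentiable (at s within I)"
    using C assms(2) by (simp add: differentiable_on_def)
  then show ?thesis
    by (rule differentiable_transform_within[OF _ zero_less_one assms(2)]) (simp add: eq)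
qed

text \<open>
  The curvature \<open>w \<kappa>\<close> and the normal plane of the mate are read off from \<open>N'\<close>. Then the constant
  function \<open>\<langle>B\<^sub>\<beta>, - T + H B\<rangle> = 0\<close> is differentiated, which expresses \<open>B\<^sub>\<beta>'\<close>, and with it \<open>H\<^sub>\<beta>\<close>,
  by \<open>H'\<close> without differentiating the length \<open>w\<close> of \<open>- T + H B\<close>.
\<close>

lemma mate_harmonic_curvature:
  fixes T N B M C :: "real \<Rightarrow> real^3" and \<kappa> \<kappa>m H Hm :: "real \<Rightarrow> real"
  assumes perfect: "\<And>r. r \<in> I \<Longrightarrow> at r within I \<noteq> bot" and s: "s \<in> I"
    and frame: "\<And>r. r \<in> I \<Longrightarrow> pos_orthonormal (T r) (N r) (B r)"
    and mate: "\<And>r. r \<in> I \<Longrightarrow> pos_orthonormal (N r) (M r) (C r)"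
    and pos: "\<And>r. r \<in> I \<Longrightarrow> \<kappa> r > 0" "\<And>r. r \<in> I \<Longrightarrow> \<kappa>m r > 0"
    and dT: "(T has_vector_derivative \<kappa> s *\<^sub>R N s) (at s within I)"
    and dN: "\<And>r. r \<in> I \<Longrightarrow>
      (N has_vector_derivative - \<kappa> r *\<^sub>R T r + (\<kappa> r * H r) *\<^sub>R B r) (at r within I)"
    and dB: "(B has_vector_derivative - (\<kappa> s * H s) *\<^sub>R N s) (at s within I)"
    and dNm: "\<And>r. r \<in> I \<Longrightarrow> (N has_vector_derivative \<kappa>m r *\<^sub>R M r) (at r within I)"
    and dC: "(C has_vector_derivative - (\<kappa>m s * Hm s) *\<^sub>R M s) (at s within I)"
    and dH: "(H has_vector_derivative H') (at s within I)"
  shows "Hm s = H' / (\<kappa> s * ((H s)\<^sup>2 + 1) powr (3/2))"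
proof -
  define V where "V = (\<lambda>r. - T r + H r *\<^sub>R B r)"
  define w where "w = \<kappa>m s / \<kappa> s"
  have w: "w > 0" using pos s by (simp add: w_def)
  have VM: "V r = (\<kappa>m r / \<kappa> r) *\<^sub>R M r" if "r \<in> I" for r
  proof -
    have "\<kappa> r *\<^sub>R V r = \<kappa>m r *\<^sub>R M r"
      using vector_derivative_unique_within[OF perfect[OF that] dN[OF that] dNm[OF that]]
      by (simp add: V_def scaleR_right_diff_distrib)
    then have "(1 / \<kappa> r) *\<^sub>R (\<kappa> r *\<^sub>R V r) = (1 / \<kappa> r) *\<^sub>R (\<kappa>m r *\<^sub>R M r)"
      by simp
    then show ?thesis using pos(1)[OF that] by simp
  qed
  have Vw: "V s = w *\<^sub>R M s" using VM[OF s] by (simp add: w_def)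
  have on: "T s \<bullet> T s = 1" "N s \<bullet> N s = 1" "B s \<bullet> B s = 1" "T s \<bullet> N s = 0" "T s \<bullet> B s = 0"
      "N s \<bullet> B s = 0" "M s \<bullet> M s = 1" "N s \<bullet> C s = 0"
    using frame[OF s] mate[OF s] by (simp_all add: pos_orthonormal_def norm_eq_1)
  have w2: "w\<^sup>2 = (H s)\<^sup>2 + 1"
  proof -
    have "w\<^sup>2 = V s \<bullet> V s" using on(7) by (simp add: Vw power2_eq_square)
    also have "\<dots> = (H s)\<^sup>2 + 1"
      using on by (simp add: V_def inner_diff inner_add inner_commute power2_eq_square)
    finally show ?thesis .
  qed
  \<comment> \<open>The binormal of the mate is \<open>N \<times> (V / w) = (B + H T) / w\<close>.\<close>
  have BC: "B s \<bullet> C s = 1 / w"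
  proof -
    have "w *\<^sub>R C s = cross3 (N s) (V s)"
      by (simp add: Vw cross_mult_right pos_orthonormal_cross[OF mate[OF s]])
    then have "w * (B s \<bullet> C s) = B s \<bullet> cross3 (N s) (V s)"
      by (metis inner_scaleR_right)
    also have "\<dots> = - (cross3 (B s) (N s) \<bullet> T s)"
    proof -
      have "B s \<bullet> cross3 (N s) (V s) = cross3 (B s) (N s) \<bullet> V s"
        by (metis cross_triple inner_commute)
      then show ?thesis
        by (simp add: V_def inner_add inner_diff dot_cross_self)
    qed
    also have "\<dots> = cross3 (T s) (N s) \<bullet> B s"
      by (metis cross_skew cross_triple inner_commute inner_minus_left minus_minus)
    also have "\<dots> = 1"
      using pos_orthonormal_cross[OF frame[OF s]] on(3) by simp
    finally show ?thesis using w by (simp add: field_simps)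
  qed
  have dV: "(V has_vector_derivative H' *\<^sub>R B s - (\<kappa> s * (1 + (H s)\<^sup>2)) *\<^sub>R N s) (at s within I)"
  proof -
    have "(V has_vector_derivative
        - (\<kappa> s *\<^sub>R N s) + (H s *\<^sub>R (- (\<kappa> s * H s) *\<^sub>R N s) + H' *\<^sub>R B s)) (at s within I)"
      unfolding V_def
      by (intro has_vector_derivative_add has_vector_derivative_minus dT
          has_vector_derivative_scaleR dB)
        (use dH in \<open>simp add: has_real_derivative_iff_has_vector_derivative\<close>)
    then show ?thesis
      by (simp add: algebra_simps power2_eq_square)
  qed
  have CV: "C r \<bullet> V r = 0" if "r \<in> I" for r
    using mate[OF that] by (simp add: VM[OF that] pos_orthonormal_def inner_commute)
  have "- (\<kappa>m s * Hm s) *\<^sub>R M s \<bullet> V s + C s \<bullet> (H' *\<^sub>R B s - (\<kappa> s * (1 + (H s)\<^sup>2)) *\<^sub>R N s) = 0"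
    using inner_const_derivative[OF perfect[OF s] s dC dV CV] .
  then have "\<kappa>m s * Hm s * w = H' / w"
    using on BC by (simp add: Vw inner_diff inner_commute)
  moreover have "\<kappa>m s = w * \<kappa> s"
    using pos(1)[OF s] by (simp add: w_def)
  ultimately have "Hm s = H' / (\<kappa> s * w ^ 3)"
    using w pos(1)[OF s] by (simp add: field_simps power3_eq_cube)
  moreover have "w ^ 3 = ((H s)\<^sup>2 + 1) powr (3/2)"
  proof -
    have "((H s)\<^sup>2 + 1) powr (3/2) = (w powr 2) powr (3/2)"
      using w by (simp add: w2)
    also have "\<dots> = w ^ 3"
      by (subst powr_powr) (use w in simp)
    finally show ?thesis by simp
  qed
  ultimately show ?thesis by simp
qed


section \<open>Frenet frames in the left trivialization\<close>

lemma frenet_apparatusD: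
  assumes "frenet_apparatus G A g X I \<gamma> T N B \<kappa> \<tau>" and "s \<in> I"
  shows "pos_orthonormal (T s) (N s) (B s)" and "\<kappa> s > 0"
    and "nabla G g X I T T s = \<kappa> s *\<^sub>R N s"
    and "nabla G g X I T N s = - \<kappa> s *\<^sub>R T s + \<tau> s *\<^sub>R B s"
  using assms unfolding frenet_apparatus_def by blast+

text \<open>
  Frenet's equations prescribe only the covariant derivatives. Their bracket terms are known just
  for \<open>T\<close>, where \<open>[T, T] = 0\<close>, and for the \<open>B\<close>-component of \<open>[T, N]\<close>, which is \<open>2 \<tau>\<^sub>G\<close> by definition.
  The other components of \<open>N'\<close> and \<open>B'\<close> follow from the skew-symmetry of the derivative of an
  orthonormal frame.
\<close>

lemma frenet_frame_equations:
  fixes G g X T N B \<kappa> \<tau>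
  defines "H \<equiv> harmonic_curvature G g X T N B \<kappa> \<tau>"
  assumes alt: "\<And>u. lie_br G g X u u = 0"
    and ap: "frenet_apparatus G A g X I \<gamma> T N B \<kappa> \<tau>"
    and perfect: "at s within I \<noteq> bot" and s: "s \<in> I"
  shows "(T has_vector_derivative \<kappa> s *\<^sub>R N s) (at s within I)"
    and "(N has_vector_derivative - \<kappa> s *\<^sub>R T s + (\<kappa> s * H s) *\<^sub>R B s) (at s within I)"
    and "(B has_vector_derivative - (\<kappa> s * H s) *\<^sub>R N s) (at s within I)"
proof -
  let ?d = "\<lambda>U. vector_derivative U (at s within I)"
  have d: "(T has_vector_derivative ?d T) (at s within I)"
      "(N has_vector_derivative ?d N) (at s within I)"
      "(B has_vector_derivative ?d B) (at s within I)"
    using ap s by (auto simp: frenet_apparatus_def intro: smooth_on_has_vector_derivative)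
  have frame: "pos_orthonormal (T r) (N r) (B r)" if "r \<in> I" for r
    using frenet_apparatusD(1)[OF ap that] .
  then have on: "T r \<bullet> T r = 1" "N r \<bullet> N r = 1" "B r \<bullet> B r = 1"
      "T r \<bullet> N r = 0" "T r \<bullet> B r = 0" "N r \<bullet> B r = 0" if "r \<in> I" for r
    using that by (simp_all add: pos_orthonormal_def norm_eq_1)
  note const = inner_const_derivative[OF perfect s]
  have dT: "?d T = \<kappa> s *\<^sub>R N s"
    using frenet_apparatusD(3)[OF ap s] by (simp add: nabla_def alt)
  have kH: "\<kappa> s * H s = \<tau> s - lie_torsion G g X T N B s"
    using frenet_apparatusD(2)[OF ap s] by (simp add: H_def harmonic_curvature_def)
  have NB: "?d N \<bullet> B s = \<kappa> s * H s"
  proof -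
    have "?d N + (1/2) *\<^sub>R lie_br G g X (T s) (N s) = - \<kappa> s *\<^sub>R T s + \<tau> s *\<^sub>R B s"
      using frenet_apparatusD(4)[OF ap s] by (simp add: nabla_def)
    then have "(?d N + (1/2) *\<^sub>R lie_br G g X (T s) (N s)) \<bullet> B s
        = (- \<kappa> s *\<^sub>R T s + \<tau> s *\<^sub>R B s) \<bullet> B s"
      by simp
    then show ?thesis
      using on[OF s] by (simp add: inner_add inner_diff kH lie_torsion_def)
  qed
  have NT: "?d N \<bullet> T s = - \<kappa> s"
    using const[OF d(1,2) on(4)] on[OF s] by (simp add: dT inner_commute)
  have NN: "?d N \<bullet> N s = 0"
    using const[OF d(2,2) on(2)] by (simp add: inner_commute)
  have BT: "?d B \<bullet> T s = 0"
    using const[OF d(1,3) on(5)] on[OF s] by (simp add: dT inner_commute)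
  have BN: "?d B \<bullet> N s = - (\<kappa> s * H s)"
    using const[OF d(2,3) on(6)] NB by (simp add: inner_commute)
  have BB: "?d B \<bullet> B s = 0"
    using const[OF d(3,3) on(3)] by (simp add: inner_commute)
  have dN: "?d N = - \<kappa> s *\<^sub>R T s + (\<kappa> s * H s) *\<^sub>R B s"
    using pos_orthonormal_expand[OF frame[OF s], of "?d N"] by (simp add: NT NN NB)
  have dB: "?d B = - (\<kappa> s * H s) *\<^sub>R N s"
    using pos_orthonormal_expand[OF frame[OF s], of "?d B"] by (simp add: BT BN BB)
  show "(T has_vector_derivative \<kappa> s *\<^sub>R N s) (at s within I)"
    and "(N has_vector_derivative - \<kappa> s *\<^sub>R T s + (\<kappa> s * H s) *\<^sub>R B s) (at s within I)"
    and "(B has_vector_derivative - (\<kappa> s * H s) *\<^sub>R N s) (at s within I)"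
    using d unfolding dT dN dB .
qed

text \<open>
  Curvature and torsion are not assumed to be differentiable, but \<open>H\<close> is the quotient of
  \<open>\<langle>N', B\<rangle> = \<kappa> H\<close> and \<open>\<langle>T', N\<rangle> = \<kappa>\<close>, and the frame fields are smooth.
\<close>

lemma harmonic_curvature_differentiable:
  assumes alt: "\<And>u. lie_br G g X u u = 0"
    and ap: "frenet_apparatus G A g X I \<gamma> T N B \<kappa> \<tau>"
    and perfect: "\<And>r. r \<in> I \<Longrightarrow> at r within I \<noteq> bot" and s: "s \<in> I"
  shows "harmonic_curvature G g X T N B \<kappa> \<tau> differentiable (at s within I)"
proof -
  let ?H = "harmonic_curvature G g X T N B \<kappa> \<tau>"
  let ?k = "\<lambda>r. vector_derivative T (at r within I) \<bullet> N r"
  let ?h = "\<lambda>r. vector_derivative N (at r within I) \<bullet> B r"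
  have sm: "smooth_on I T" "smooth_on I N" "smooth_on I B"
    using ap by (simp_all add: frenet_apparatus_def)
  have on: "T r \<bullet> B r = 0" "N r \<bullet> N r = 1" "B r \<bullet> B r = 1" and pos: "\<kappa> r > 0" if "r \<in> I" for r
    using frenet_apparatusD(1,2)[OF ap that] by (simp_all add: pos_orthonormal_def norm_eq_1)
  have k: "?k r = \<kappa> r" and h: "?h r = \<kappa> r * ?H r" if "r \<in> I" for r
    using frenet_frame_equations(1,2)[OF alt ap perfect[OF that] that]
    by (simp_all add: vector_derivative_within[OF perfect[OF that]] inner_diff on[OF that])
  have U: "U differentiable (at s within I)" if "smooth_on I U" for U :: "real \<Rightarrow> real^3"
    using smooth_on_has_vector_derivative[OF that s] differentiableI_vector by blast
  have "(\<lambda>r. ?h r / ?k r) differentiable (at s within I)"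
    using smooth_on_vector_derivative_differentiable[OF sm(1) s perfect]
      smooth_on_vector_derivative_differentiable[OF sm(2) s perfect] U sm k[OF s] pos[OF s]
    by (intro differentiable_divide differentiable_inner) auto
  then show ?thesis
    by (rule differentiable_transform_within[OF _ zero_less_one s]) (use pos k h in force)
qed


section \<open>Slant helices and their natural mates\<close>

theorem corollary3p2:
  fixes G :: "'g::{t2_space, second_countable_topology} monoid"
    and A :: "'g chart set" and g :: "'g metric" and X :: "3 \<Rightarrow> 'g \<Rightarrow> 'g tangent"
    and I :: "real set" and \<gamma> \<beta> :: "real \<Rightarrow> 'g"
    and T N B Tbar Nbar Bbar :: "real \<Rightarrow> real^3"
    and \<kappa> \<tau> \<kappa>bar \<tau>bar :: "real \<Rightarrow> real"
  assumes "lie_group3 G A"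
    and "bi_invariant_metric G A g"
    and "left_orthonormal_basis G A g X"
    and "is_interval I" and "interior I \<noteq> {}"
    and "frenet_curve G A g X I \<gamma> T N B \<kappa> \<tau>"
    and "frenet_apparatus G A g X I \<beta> Tbar Nbar Bbar \<kappa>bar \<tau>bar"
    and "natural_mate I N Tbar"
  shows "slant_helix I \<kappa> (harmonic_curvature G g X T N B \<kappa> \<tau>) \<longleftrightarrow>
         general_helix I (harmonic_curvature G g X Tbar Nbar Bbar \<kappa>bar \<tau>bar)"
proof -
  let ?H = "harmonic_curvature G g X T N B \<kappa> \<tau>"
  let ?Hm = "harmonic_curvature G g X Tbar Nbar Bbar \<kappa>bar \<tau>bar"
  have alt: "lie_br G g X u u = 0" for u
    using assms(1-3)
    by (intro lie_br_self[of A])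
      (auto simp: lie_group3_def bi_invariant_metric_def left_orthonormal_basis_def)
  \<comment> \<open>Derivatives within \<open>I\<close> are unique, also at end points that belong to \<open>I\<close>.\<close>
  have perfect: "at r within I \<noteq> bot" if "r \<in> I" for r
  proof -
    have "I \<noteq> {x}" for x using assms(5) by auto
    then have "r islimpt I"
      using connected_imp_perfect is_interval_connected[OF assms(4)] that by blast
    then show ?thesis by (simp add: trivial_limit_within)
  qed
  have ap: "frenet_apparatus G A g X I \<gamma> T N B \<kappa> \<tau>"
    using assms(6) by (simp add: frenet_curve_def)
  have mate: "Tbar r = N r" if "r \<in> I" for r
    using assms(8) that by (simp add: natural_mate_def)
  note F = frenet_frame_equations[OF alt ap perfect]
  note Fm = frenet_frame_equations[OF alt assms(7) perfect]
  have inv: "slant_sigma I \<kappa> ?H s = 1 / ?Hm s" if s: "s \<in> I" for s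
  proof -
    have "?Hm s = vector_derivative ?H (at s within I) / (\<kappa> s * ((?H s)\<^sup>2 + 1) powr (3/2))"
    proof (rule mate_harmonic_curvature[OF perfect s, where T = T and N = N and B = B
          and M = Nbar and C = Bbar and \<kappa>m = \<kappa>bar])
      show "(N has_vector_derivative \<kappa>bar r *\<^sub>R Nbar r) (at r within I)" if "r \<in> I" for r
        using has_vector_derivative_transform[OF that _ Fm(1)[OF that that], of N] mate by simp
      show "(?H has_vector_derivative vector_derivative ?H (at s within I)) (at s within I)"
        using harmonic_curvature_differentiable[OF alt ap perfect s] by (simp add: vector_derivative_works)
      show "pos_orthonormal (N r) (Nbar r) (Bbar r)" if "r \<in> I" for r
        using frenet_apparatusD(1)[OF assms(7) that] mate[OF that] by simp
      show "(N has_vector_derivative - \<kappa> r *\<^sub>R T r + (\<kappa> r * ?H r) *\<^sub>R B r) (at r within I)"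
        if "r \<in> I" for r
        using F(2)[OF that that] .
    qed (fact frenet_apparatusD(1,2)[OF ap] frenet_apparatusD(2)[OF assms(7)]
        F(1,3)[OF s s] Fm(3)[OF s s] | assumption)+
    then show ?thesis by (simp add: slant_sigma_def)
  qed
  show ?thesis
    unfolding slant_helix_def general_helix_def constant_on_def
  proof
    assume "\<exists>y. \<forall>s\<in>I. slant_sigma I \<kappa> ?H s = y"
    then obtain y where "\<forall>s\<in>I. 1 / ?Hm s = y" using inv by auto
    then have "\<forall>s\<in>I. ?Hm s = 1 / y" by auto
    then show "\<exists>y. \<forall>s\<in>I. ?Hm s = y" by blast
  qed (use inv in auto)
qed

end
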